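(* Let $(P,\preceq)$ be a locally finite lattice and let $f:P\to\mathbb{C}$ be semimultiplicative with $f(x)\neq0$ for all $x\in P$. Let $X=\{x_1,\dots,x_n\}$ and $Y=\{y_1,\dots,y_n\}$ be subsets of $P$ indexed so that $x_i\preceq x_j\Rightarrow i\le j$ and $y_i\preceq y_j\Rightarrow i\le j$, and let $D=\{d_1,\dots,d_m\}$ be any finite subset of $P$ containing all $x_i\vee y_j$, indexed so that $d_i\preceq d_j\Rightarrow i\le j$. Then $$(X,Y)_f=\Delta_{X,f}[X,Y]_{1/f}\Delta_{Y,f}\quad\text{and}\quad (X,Y)_f=\Delta_{X,f}E(X)\Lambda_{D,1/f}E(Y)^T\Delta_{Y,f},$$ where $\Delta_{X,f}=\mathrm{diag}(f(x_1),\dots,f(x_n))$ and $\Delta_{Y,f}=\mathrm{diag}(f(y_1),\dots,f(y_n))$.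
   Context: $f$ is semimultiplicative if $f(x)f(y)=f(x\wedge y)f(x\vee y)$ for all $x,y\in P$. $(X,Y)_f$ is the $n\times n$ matrix with $(i,j)$ entry $f(x_i\wedge y_j)$, and $[X,Y]_{1/f}$ the $n\times n$ matrix with $(i,j)$ entry $1/f(x_i\vee y_j)$. For $g:P\to\mathbb{C}$, $\Psi_{D,g}$ is defined on $D$ recursively by $\Psi_{D,g}(d_k)=g(d_k)-\sum_{d_v\in D,\ d_k\prec d_v}\Psi_{D,g}(d_v)$; $\Lambda_{D,1/f}=\mathrm{diag}(\Psi_{D,1/f}(d_1),\dots,\Psi_{D,1/f}(d_m))$. $E(X)$ is the $n\times m$ matrix with $(i,j)$ entry $1$ if $x_i\preceq d_j$ and $0$ otherwise; $E(Y)$ likewise with $y_i$. *)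

theory Defs
  imports Complex_Main "Jordan_Normal_Form.Matrix"
begin

definition semimultiplicative :: "('a::lattice \<Rightarrow> complex) \<Rightarrow> bool" where
  "semimultiplicative f \<longleftrightarrow> (\<forall>x y. f x * f y = f (inf x y) * f (sup x y))"

definition locally_finite :: "'a::order itself \<Rightarrow> bool" where
  "locally_finite _ \<longleftrightarrow> (\<forall>a b :: 'a. finite {a..b})"

text \<open>
  An indexed finite set \<open>A = {a\<^sub>1, \<dots>, a\<^sub>k}\<close> is a list, with \<open>a\<^sub>i\<close> at the zero-based position
  \<open>i - 1\<close>.
\<close>

definition ordered_indexing :: "'a::order set \<Rightarrow> 'a list \<Rightarrow> bool" where
  "ordered_indexing A as \<longleftrightarrow> set as = A \<and> distinct as \<and>
     (\<forall>i<length as. \<forall>j<length as. as ! i \<le> as ! j \<longrightarrow> i \<le> j)"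

definition meet_mat :: "'a::lattice list \<Rightarrow> 'a list \<Rightarrow> ('a \<Rightarrow> complex) \<Rightarrow> complex mat" where
  "meet_mat xs ys g = mat (length xs) (length ys) (\<lambda>(i, j). g (inf (xs ! i) (ys ! j)))"

definition join_mat :: "'a::lattice list \<Rightarrow> 'a list \<Rightarrow> ('a \<Rightarrow> complex) \<Rightarrow> complex mat" where
  "join_mat xs ys g = mat (length xs) (length ys) (\<lambda>(i, j). g (sup (xs ! i) (ys ! j)))"

text \<open>The recursion is well-founded only for finite \<open>D\<close>; the value for infinite \<open>D\<close> is a dummy.\<close>

function Psi :: "'a::order set \<Rightarrow> ('a \<Rightarrow> complex) \<Rightarrow> 'a \<Rightarrow> complex" where
  "Psi D g d = (if finite D then g d - (\<Sum>v\<in>{v\<in>D. d < v}. Psi D g v) else 0)"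
  by pat_completeness auto
termination
proof (relation "measure (\<lambda>(D, g, d). card {v\<in>D. d < v})")
  show "wf (measure (\<lambda>(D, g, d). card {v\<in>D. d < v}))" by simp
next
  fix D :: "'a set" and g :: "'a \<Rightarrow> complex" and d v :: 'a
  assume "finite D" and "v \<in> {v\<in>D. d < v}"
  then have "card {w\<in>D. v < w} < card {w\<in>D. d < w}"
    by (intro psubset_card_mono) auto
  then show "((D, g, v), (D, g, d)) \<in> measure (\<lambda>(D, g, d). card {v\<in>D. d < v})"
    by simp
qed

declare Psi.simps [simp del]

definition diag_of :: "'a list \<Rightarrow> ('a \<Rightarrow> complex) \<Rightarrow> complex mat" where
  "diag_of as g = mat_diag (length as) (\<lambda>i. g (as ! i))"

definition Lambda_mat :: "'a::order list \<Rightarrow> ('a \<Rightarrow> complex) \<Rightarrow> complex mat" where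
  "Lambda_mat ds g = diag_of ds (Psi (set ds) g)"

definition E_mat :: "'a::order list \<Rightarrow> 'a list \<Rightarrow> complex mat" where
  "E_mat ds xs = mat (length xs) (length ds) (\<lambda>(i, j). if xs ! i \<le> ds ! j then 1 else 0)"

end

theory Submission
  imports Defs
begin

text \<open>
  Dividing \<open>f x * f y = f (inf x y) * f (sup x y)\<close> by \<open>f (sup x y)\<close> gives the first factorization.
  The recursion for \<^const>\<open>Psi\<close> is Moebius inversion from above on \<open>D\<close>: the values of
  \<open>Psi D g\<close> at the elements of \<open>D\<close> above \<open>d \<in> D\<close> add up to \<open>g d\<close>. Since \<open>x \<le> d\<close> and \<open>y \<le> d\<close>
  together mean \<open>sup x y \<le> d\<close>, the entries of \<open>E(X) \<Lambda> E(Y)\<^sup>T\<close> are such sums with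
  \<open>sup x y\<close> in place of \<open>d\<close>, so this product is the join matrix.
\<close>

lemma sum_Psi_above:
  assumes "finite D" "d \<in> D"
  shows "(\<Sum>v\<in>{v\<in>D. d \<le> v}. Psi D g v) = g d"
proof -
  \<comment> \<open>As \<open>d\<close> lies in \<open>D\<close>, it contributes its own term, which
    the recursion gives as \<open>g d\<close> minus the sum strictly above; that sum then
    cancels.\<close>
  have "{v\<in>D. d \<le> v} = insert d {v\<in>D. d < v}"
    using assms(2) by (auto simp: le_less)
  then show ?thesis
    using assms(1) Psi.simps[of D g d] by simp
qed

lemma diag_of_mult_left:
  assumes "A \<in> carrier_mat (length as) nc"
  shows "diag_of as g * A = mat (length as) nc (\<lambda>(i, j). g (as ! i) * A $$ (i, j))"
  using mat_diag_mult_left[OF assms] by (simp add: diag_of_def)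

lemma diag_of_mult_right:
  assumes "A \<in> carrier_mat nr (length as)"
  shows "A * diag_of as g = mat nr (length as) (\<lambda>(i, j). A $$ (i, j) * g (as ! j))"
  using mat_diag_mult_right[OF assms] by (simp add: diag_of_def)

lemma diag_of_carrier [simp]: "diag_of as g \<in> carrier_mat (length as) (length as)"
  by (simp add: diag_of_def)

lemma Lambda_mat_carrier [simp]: "Lambda_mat ds g \<in> carrier_mat (length ds) (length ds)"
  by (simp add: Lambda_mat_def)

lemma E_mat_carrier [simp]: "E_mat ds xs \<in> carrier_mat (length xs) (length ds)"
  by (simp add: E_mat_def)

lemma join_mat_carrier [simp]: "join_mat xs ys g \<in> carrier_mat (length xs) (length ys)"
  by (simp add: join_mat_def)

lemma join_mat_factorization:
  assumes "distinct ds"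
    and "\<And>x y. x \<in> set xs \<Longrightarrow> y \<in> set ys \<Longrightarrow> sup x y \<in> set ds"
  shows "E_mat ds xs * Lambda_mat ds g * transpose_mat (E_mat ds ys) = join_mat xs ys g"
proof (rule eq_matI)
  fix i j
  assume "i < dim_row (join_mat xs ys g)" "j < dim_col (join_mat xs ys g)"
  then have ij: "i < length xs" "j < length ys"
    by (simp_all add: join_mat_def)
  let ?P = "Psi (set ds) g" and ?z = "sup (xs ! i) (ys ! j)"
  \<comment> \<open>The diagonal factor leaves a single summation index; the two 0/1 entries
    multiply to the indicator of lying above the join \<open>?z\<close>.\<close>
  have "(E_mat ds xs * Lambda_mat ds g * transpose_mat (E_mat ds ys)) $$ (i, j) =
    (\<Sum>k<length ds. if ?z \<le> ds ! k then ?P (ds ! k) else 0)"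
    using ij unfolding Lambda_mat_def diag_of_mult_right[OF E_mat_carrier]
    by (auto simp: E_mat_def scalar_prod_def lessThan_atLeast0 intro!: sum.cong)
  also have "\<dots> = (\<Sum>d\<in>set ds. if ?z \<le> d then ?P d else 0)"
    \<comment> \<open>Distinctness makes positions of \<open>ds\<close> correspond bijectively to
      elements of \<open>set ds\<close>.\<close>
    using sum.reindex_bij_betw[OF bij_betw_nth[OF assms(1) refl refl]] .
  also have "\<dots> = (\<Sum>d\<in>{d\<in>set ds. ?z \<le> d}. ?P d)"
    by (simp add: sum.inter_filter)
  also have "\<dots> = g ?z"
    \<comment> \<open>Inversion applies at \<open>?z\<close> because \<open>ds\<close> contains all
      the joins.\<close>
    using ij by (intro sum_Psi_above assms(2)) auto
  finally show "(E_mat ds xs * Lambda_mat ds g * transpose_mat (E_mat ds ys)) $$ (i, j) =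
    join_mat xs ys g $$ (i, j)"
    using ij by (simp add: join_mat_def)
qed (simp_all add: E_mat_def join_mat_def)

lemma meet_mat_eq_join_mat:
  assumes "semimultiplicative f" "\<And>x. f x \<noteq> 0"
  shows "meet_mat xs ys f = diag_of xs f * join_mat xs ys (\<lambda>z. 1 / f z) * diag_of ys f"
proof -
  have "f (inf x y) = f x * (1 / f (sup x y)) * f y" for x y
    using assms by (simp add: semimultiplicative_def field_simps)
  then show ?thesis
    unfolding diag_of_mult_left[OF join_mat_carrier]
    by (subst diag_of_mult_right) (auto simp: meet_mat_def join_mat_def)
qed

theorem theorem6p1:
  fixes f :: "'a::lattice \<Rightarrow> complex"
    and X Y D :: "'a set" and xs ys ds :: "'a list" and n m :: nat
  assumes "locally_finite TYPE('a)"
    and "semimultiplicative f"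
    and "\<And>x. f x \<noteq> 0"
    and "ordered_indexing X xs" and "length xs = n"
    and "ordered_indexing Y ys" and "length ys = n"
    and "ordered_indexing D ds" and "length ds = m"
    and "\<And>x y. x \<in> X \<Longrightarrow> y \<in> Y \<Longrightarrow> sup x y \<in> D"
  shows "meet_mat xs ys f = diag_of xs f * join_mat xs ys (\<lambda>z. 1 / f z) * diag_of ys f
       \<and> meet_mat xs ys f =
           diag_of xs f * E_mat ds xs * Lambda_mat ds (\<lambda>z. 1 / f z) * transpose_mat (E_mat ds ys)
             * diag_of ys f"
proof -
  let ?g = "\<lambda>z. 1 / f z"
  have fact1: "meet_mat xs ys f = diag_of xs f * join_mat xs ys ?g * diag_of ys f"
    using assms(2,3) by (rule meet_mat_eq_join_mat)
  have "join_mat xs ys ?g = E_mat ds xs * Lambda_mat ds ?g * transpose_mat (E_mat ds ys)"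
    using assms(4,6,8,10) by (intro join_mat_factorization[symmetric]) (auto simp: ordered_indexing_def)
  moreover have "diag_of xs f * (E_mat ds xs * Lambda_mat ds ?g * transpose_mat (E_mat ds ys)) =
    diag_of xs f * E_mat ds xs * Lambda_mat ds ?g * transpose_mat (E_mat ds ys)"
    \<comment> \<open>Both sides are bracketed to the right. The inner dimensions occur only in the
      premises of associativity, so each instance fixes them.\<close>
    by (simp add: assoc_mult_mat[of _ "length xs" "length xs" _ "length ds" _ "length ys"]
        assoc_mult_mat[of _ "length xs" "length xs" _ "length ds" _ "length ds"]
        assoc_mult_mat[of _ "length xs" "length ds" _ "length ds" _ "length ys"]
        mult_carrier_mat[of _ _ "length ds"] mult_carrier_mat[of _ _ "length xs"])
  ultimately show ?thesis
    using fact1 by simp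
qed

end
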